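(* Let $H$ be a real Hilbert space, let $F:H\to H$ be monotone and continuous, let $f\in H$ be such that the equation $F(u)=f$ has a solution in $H$, and let $y$ be the minimal-norm solution of this equation. Let $0<\gamma<1$, $C>0$, $\theta>0$ and $0<C_1<C_2$ be constants, and let $\delta_0\in(0,1]$. Suppose that for every $\delta\in(0,\delta_0)$ an element $f_\delta\in H$ is given with $$\|f_\delta-f\|\le\delta,\qquad C\delta^\gamma>\delta,\qquad \|F(0)-f_\delta\|>C\delta^\gamma,$$ and that $v_\delta\in H$ and $\alpha(\delta)>0$ satisfy $$\|F(v_\delta)+\alpha(\delta)v_\delta-f_\delta\|\le\theta\delta$$ and $$C_1\delta^\gamma\le\|F(v_\delta)-f_\delta\|\le C_2\delta^\gamma .$$ Then $$\lim_{\delta\to0}\|v_\delta-y\|=0.$$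
   Context: $\langle\cdot,\cdot\rangle$ and $\|\cdot\|$ are the inner product and norm of the real Hilbert space $H$. A map $F:H\to H$ is monotone if $\langle F(u)-F(v),u-v\rangle\ge0$ for all $u,v\in H$. The minimal-norm solution $y$ of $F(u)=f$ is the unique element of smallest norm in the (nonempty, closed, convex) solution set $\{u\in H:F(u)=f\}$. The element $f_\delta$ represents noisy data for $f$ with noise level $\delta$. The constants $\gamma,C,\theta,C_1,C_2$ do not depend on $\delta$. *)

theory Defs
  imports "HOL-Analysis.Analysis"
begin

text \<open>Real Hilbert spaces are rendered by the sort \<open>{real_inner, complete_space}\<close>.\<close>

(* Monotonicity in the operator sense; unrelated to the order-theoretic constant "monotone". *)
definition monotone_operator :: "('a::real_inner \<Rightarrow> 'a) \<Rightarrow> bool" where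
  "monotone_operator F \<longleftrightarrow> (\<forall>u v. (F u - F v) \<bullet> (u - v) \<ge> 0)"

(* Uniqueness is not part of the definition: for monotone continuous F on a Hilbert space
   the solution set is closed and convex, so its element of smallest norm is unique. *)
definition minimal_norm_solution ::
    "('a::real_normed_vector \<Rightarrow> 'a) \<Rightarrow> 'a \<Rightarrow> 'a \<Rightarrow> bool" where
  "minimal_norm_solution F f y \<longleftrightarrow> is_arg_min norm (\<lambda>u. F u = f) y"

end

theory Submission
  imports Defs
begin

text \<open>Testing monotonicity of \<open>F\<close> against \<open>y\<close> bounds the norm of \<open>v \<delta>\<close> by a quantity tending to
  the norm of \<open>y\<close>, because the discrepancy bound forces
  \<open>\<delta> / \<alpha> \<delta>\<close> to be small compared with the norm of \<open>v \<delta>\<close>. By Minty's trick the solution set is the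
  intersection of the closed convex sets of approximate solutions of the dual inequality
  \<open>(F u - f) \<bullet> (u - z) \<ge> 0\<close>, and \<open>v \<delta>\<close> eventually enters each of them. A nested sequence of
  closed convex sets in a Hilbert space has minimal norms converging to the minimal norm of the
  intersection, so the parallelogram law squeezes \<open>v \<delta>\<close> and \<open>y\<close> together.\<close>

section \<open>Minimal norms along nested closed convex sets\<close>

text \<open>The parallelogram law, phrased with the midpoint because convexity supplies the lower
  bound \<open>c\<close> there: two points whose squared norms barely exceed \<open>c\<close> must
  be close.\<close>

lemma norm_diff_le_of_midpoint:
  fixes a b :: "'a::real_inner"
  assumes "c \<le> (norm ((1/2) *\<^sub>R (a + b)))\<^sup>2"
  shows "(norm (a - b))\<^sup>2 \<le> 2 * (norm a)\<^sup>2 + 2 * (norm b)\<^sup>2 - 4 * c"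
proof -
  have "(norm (a - b))\<^sup>2 = 2 * (norm a)\<^sup>2 + 2 * (norm b)\<^sup>2 - (norm (a + b))\<^sup>2"
    by (simp add: power2_norm_eq_inner inner_add inner_diff inner_commute)
  moreover have "(norm (a + b))\<^sup>2 = 4 * (norm ((1/2) *\<^sub>R (a + b)))\<^sup>2"
    by (simp add: power_mult_distrib power_divide)
  ultimately show ?thesis using assms by linarith
qed

lemma convex_midpoint:
  assumes "convex K" "a \<in> K" "b \<in> K"
  shows "(1/2) *\<^sub>R (a + b) \<in> K"
  using convexD[OF assms, of "1/2" "1/2"] by (simp add: scaleR_add_right)

text \<open>Near-minimizers of the norm on the \<open>K n\<close> form a Cauchy sequence, since
  midpoints stay in the earlier sets. Its limit lies in every \<open>K n\<close> and has norm
  \<open>D\<close>, the limit of the increasing distances \<open>d n\<close> from 0, so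
  \<open>norm y\<close> is at most \<open>D\<close>.\<close>

lemma nested_closed_convex_min_norm:
  fixes K :: "nat \<Rightarrow> 'a::{real_inner, complete_space} set"
  assumes dec: "decseq K" and cl: "\<And>n. closed (K n)" and co: "\<And>n. convex (K n)"
    and y: "\<And>n. y \<in> K n"
    and min: "\<And>p. (\<And>n. p \<in> K n) \<Longrightarrow> norm y \<le> norm p"
    and "\<epsilon> > 0"
  shows "\<exists>n. \<forall>z\<in>K n. (norm y)\<^sup>2 - \<epsilon> < (norm z)\<^sup>2"
proof -
  define d where "d n = infdist 0 (K n)" for n
  have ne: "K n \<noteq> {}" for n using y by blast
  have d0: "0 \<le> d n" for n by (simp add: d_def infdist_nonneg)
  have dle: "d n \<le> norm z" if "z \<in> K n" for n z
    using infdist_le[OF that, of 0] by (simp add: d_def)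
  have sub: "K n \<subseteq> K m" if "m \<le> n" for m n
    using dec that by (simp add: decseq_def)
  have "incseq d"
    unfolding incseq_def d_def using infdist_mono[OF sub ne] by blast
  moreover have "d n \<le> norm y" for n using dle y by blast
  ultimately obtain D where D: "d \<longlonglongrightarrow> D"
    using incseq_convergent[of d "norm y"] by blast
  have "\<exists>z\<in>K n. norm z < d n + 1 / real (Suc n)" for n
  proof -
    have "(INF a\<in>K n. dist 0 a) < d n + 1 / real (Suc n)"
      using ne by (simp add: d_def infdist_def)
    then show ?thesis
      using cINF_less_iff[OF ne[of n] bdd_below_image_dist, of 0] by simp
  qed
  then obtain p where p: "\<And>n. p n \<in> K n" "\<And>n. norm (p n) < d n + 1 / real (Suc n)"
    by metis
  have "(\<lambda>n. d n + 1 / real (Suc n)) \<longlonglongrightarrow> D + 0"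
    by (intro tendsto_add D LIMSEQ_Suc lim_1_over_n)
  then have upper: "(\<lambda>n. d n + 1 / real (Suc n)) \<longlonglongrightarrow> D"
    by simp
  have pD: "(\<lambda>n. norm (p n)) \<longlonglongrightarrow> D"
    by (rule tendsto_sandwich[OF _ _ D upper])
       (use p dle in \<open>auto intro!: always_eventually less_imp_le\<close>)
  have pD2: "(\<lambda>n. (norm (p n))\<^sup>2) \<longlonglongrightarrow> D\<^sup>2" and D2: "(\<lambda>n. (d n)\<^sup>2) \<longlonglongrightarrow> D\<^sup>2"
    by (intro tendsto_power pD D)+
  have "Cauchy p"
  proof (rule metric_CauchyI)
    fix e :: real assume "e > 0"
    \<comment> \<open>The midpoint estimate will give less than 2*(e^2/8) + 2*(e^2/8) + 4*(e^2/8),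
      which is e^2.\<close>
    then have e: "e\<^sup>2 / 8 > 0" by simp
    from order_tendstoD(2)[OF pD2, of "D\<^sup>2 + e\<^sup>2 / 8"] order_tendstoD(1)[OF D2, of "D\<^sup>2 - e\<^sup>2 / 8"] e
    have "\<forall>\<^sub>F n in sequentially. (norm (p n))\<^sup>2 < D\<^sup>2 + e\<^sup>2 / 8 \<and> D\<^sup>2 - e\<^sup>2 / 8 < (d n)\<^sup>2"
      by (simp add: eventually_conj)
    then obtain N where N: "\<And>n. n \<ge> N \<Longrightarrow> (norm (p n))\<^sup>2 < D\<^sup>2 + e\<^sup>2 / 8"
        "D\<^sup>2 - e\<^sup>2 / 8 < (d N)\<^sup>2"
      by (auto simp: eventually_sequentially)
    have "dist (p m) (p n) < e" if "m \<ge> N" "n \<ge> N" for m n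
    proof -
      \<comment> \<open>Both points lie in \<open>K N\<close> by nesting, so the norm of their
        midpoint is at least \<open>d N\<close>.\<close>
      have "(1/2) *\<^sub>R (p m + p n) \<in> K N"
        using p(1) sub that by (intro convex_midpoint co) blast+
      then have "(d N)\<^sup>2 \<le> (norm ((1/2) *\<^sub>R (p m + p n)))\<^sup>2"
        by (intro power_mono dle d0)
      from norm_diff_le_of_midpoint[OF this] N(1)[OF that(1)] N(1)[OF that(2)] N(2)
      have "(norm (p m - p n))\<^sup>2 < e\<^sup>2" by argo
      then show ?thesis using \<open>e > 0\<close> by (simp add: dist_norm power_less_imp_less_base)
    qed
    then show "\<exists>M. \<forall>m\<ge>M. \<forall>n\<ge>M. dist (p m) (p n) < e" by blast
  qed
  then obtain q where q: "p \<longlonglongrightarrow> q"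
    using Cauchy_convergent convergent_def by blast
  have "q \<in> K n" for n
  proof (rule Lim_in_closed_set[OF cl _ _ q])
    show "\<forall>\<^sub>F k in sequentially. p k \<in> K n"
      unfolding eventually_sequentially using p(1) sub by blast
  qed simp
  then have "norm y \<le> norm q" by (rule min)
  also have "norm q = D"
    using tendsto_norm[OF q] pD LIMSEQ_unique by blast
  finally have "(norm y)\<^sup>2 - \<epsilon> < D\<^sup>2"
    using \<open>\<epsilon> > 0\<close> power_mono[of "norm y" D 2] by simp
  from order_tendstoD(1)[OF D2 this] obtain n where n: "(norm y)\<^sup>2 - \<epsilon> < (d n)\<^sup>2"
    by (auto simp: eventually_sequentially)
  have "(norm y)\<^sup>2 - \<epsilon> < (norm z)\<^sup>2" if "z \<in> K n" for z
    using n power_mono[OF dle[OF that] d0, of 2] by linarith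
  then show ?thesis by blast
qed

text \<open>Eventually \<open>v x\<close> shares a set \<open>K n\<close> with \<open>y\<close>, so
  their midpoint has norm not much below that of \<open>y\<close>, while \<open>b\<close> keeps
  \<open>v x\<close> from being much longer than \<open>y\<close>; the parallelogram law then forces
  closeness.\<close>

lemma tendsto_of_nested_closed_convex:
  fixes K :: "nat \<Rightarrow> 'a::{real_inner, complete_space} set"
  assumes dec: "decseq K" and cl: "\<And>n. closed (K n)" and co: "\<And>n. convex (K n)"
    and y: "\<And>n. y \<in> K n"
    and min: "\<And>p. (\<And>n. p \<in> K n) \<Longrightarrow> norm y \<le> norm p"
    and ev: "\<And>n. \<forall>\<^sub>F x in A. v x \<in> K n"
    and bound: "\<forall>\<^sub>F x in A. norm (v x) \<le> b x" and b: "(b \<longlongrightarrow> norm y) A"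
  shows "(v \<longlongrightarrow> y) A"
proof (rule tendstoI)
  fix e :: real assume "e > 0"
  then have e: "e\<^sup>2 / 8 > 0" by simp
  obtain n where n: "\<And>z. z \<in> K n \<Longrightarrow> (norm y)\<^sup>2 - e\<^sup>2 / 8 < (norm z)\<^sup>2"
    using nested_closed_convex_min_norm[OF dec cl co y min e] by blast
  have "\<forall>\<^sub>F x in A. (b x)\<^sup>2 < (norm y)\<^sup>2 + e\<^sup>2 / 8"
    using e by (intro order_tendstoD(2)[OF tendsto_power[OF b]]) simp
  then show "\<forall>\<^sub>F x in A. dist (v x) y < e"
    using ev[of n] bound
  proof eventually_elim
    case (elim x)
    have "(norm y)\<^sup>2 - e\<^sup>2 / 8 \<le> (norm ((1/2) *\<^sub>R (v x + y)))\<^sup>2"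
      using n[OF convex_midpoint[OF co elim(2) y]] by simp
    from norm_diff_le_of_midpoint[OF this] elim(1) power_mono[OF elim(3), of 2]
    have "(norm (v x - y))\<^sup>2 \<le> 2 * (b x)\<^sup>2 + 2 * (norm y)\<^sup>2 - 4 * ((norm y)\<^sup>2 - e\<^sup>2 / 8)"
      by simp
    \<comment> \<open>By the bound on \<open>b x\<close>, the right-hand side is below e^2/4 +
      e^2/2.\<close>
    with elim(1) \<open>e > 0\<close> have "(norm (v x - y))\<^sup>2 < e\<^sup>2"
      using zero_less_power[of e 2] by argo
    then show ?case using \<open>e > 0\<close> by (simp add: dist_norm power_less_imp_less_base)
  qed
qed

section \<open>Minty's trick and approximate solution sets\<close>

text \<open>Test the inequality at \<open>p + t *\<^sub>R h\<close> with \<open>h = f - F p\<close>,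
  divide by t > 0 and let t tend to 0: continuity leaves
  \<open>- (h \<bullet> h) \<ge> 0\<close>.\<close>

lemma minty:
  fixes F :: "'a::real_inner \<Rightarrow> 'a"
  assumes cont: "continuous_on UNIV F"
    and ineq: "\<And>u. (F u - f) \<bullet> (u - p) \<ge> 0"
  shows "F p = f"
proof -
  define h where "h = f - F p"
  have "isCont F p" using cont by (simp add: continuous_on_eq_continuous_at)
  moreover have "((\<lambda>t::real. p + t *\<^sub>R h) \<longlongrightarrow> p + 0 *\<^sub>R h) (at_right 0)"
    by (intro tendsto_intros)
  ultimately have "((\<lambda>t::real. F (p + t *\<^sub>R h)) \<longlongrightarrow> F p) (at_right 0)"
    using isCont_tendsto_compose[of p F] by simp
  then have lim: "((\<lambda>t::real. (F (p + t *\<^sub>R h) - f) \<bullet> h) \<longlongrightarrow> (F p - f) \<bullet> h) (at_right 0)"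
    by (intro tendsto_intros)
  have "\<forall>\<^sub>F t in at_right (0::real). 0 \<le> (F (p + t *\<^sub>R h) - f) \<bullet> h"
    using eventually_at_right_less[of 0]
  proof eventually_elim
    case (elim t)
    then show ?case using ineq[of "p + t *\<^sub>R h"] by (simp add: zero_le_mult_iff)
  qed
  then have "0 \<le> (F p - f) \<bullet> h"
    using lim tendsto_lowerbound trivial_limit_at_right_real by blast
  also have "(F p - f) \<bullet> h = - (h \<bullet> h)"
    by (simp add: h_def inner_diff algebra_simps)
  finally have "h = 0"
    using inner_ge_zero[of h] by simp
  then show ?thesis by (simp add: h_def)
qed

text \<open>The slack grows with the norm of \<open>u\<close> so that a bounded \<open>z\<close> with \<open>F z\<close> close to \<open>f\<close> satisfies
  all the inequalities at once.\<close>

definition minty_set :: "('a::real_inner \<Rightarrow> 'a) \<Rightarrow> 'a \<Rightarrow> real \<Rightarrow> real \<Rightarrow> 'a set" where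
  "minty_set F f R \<epsilon> = {z. \<forall>u. (F u - f) \<bullet> (u - z) \<ge> - \<epsilon> * (norm u + R)}"

text \<open>For fixed \<open>u\<close> the condition is affine in \<open>z\<close>; closedness and
  convexity follow from this form.\<close>

lemma minty_set_eq_Inter_halfspaces:
  "minty_set F f R \<epsilon> = (\<Inter>u. {z. (F u - f) \<bullet> z \<le> (F u - f) \<bullet> u + \<epsilon> * (norm u + R)})"
  by (auto simp: minty_set_def inner_diff_right algebra_simps)

lemma closed_minty_set: "closed (minty_set F f R \<epsilon>)"
  unfolding minty_set_eq_Inter_halfspaces by (intro closed_INT ballI closed_halfspace_le)

lemma convex_minty_set: "convex (minty_set F f R \<epsilon>)"
  unfolding minty_set_eq_Inter_halfspaces by (intro convex_INT convex_halfspace_le)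

lemma minty_set_mono:
  assumes "\<epsilon> \<le> \<epsilon>'" and "0 \<le> R"
  shows "minty_set F f R \<epsilon> \<subseteq> minty_set F f R \<epsilon>'"
proof -
  have "- \<epsilon>' * (norm u + R) \<le> - \<epsilon> * (norm u + R)" for u
    using assms by (intro mult_right_mono) auto
  then show ?thesis unfolding minty_set_def by (blast intro: order_trans)
qed

text \<open>Monotonicity replaces \<open>F u\<close> by \<open>F z\<close>, and Cauchy-Schwarz
  bounds the remaining term by the slack.\<close>

lemma mem_minty_setI:
  assumes "monotone_operator F" "norm z \<le> R" "norm (F z - f) \<le> \<epsilon>"
  shows "z \<in> minty_set F f R \<epsilon>"
  unfolding minty_set_def mem_Collect_eq
proof
  fix u
  have "\<bar>(F z - f) \<bullet> (u - z)\<bar> \<le> norm (F z - f) * norm (u - z)"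
    by (rule Cauchy_Schwarz_ineq2)
  also have "\<dots> \<le> \<epsilon> * (norm u + R)"
    using assms(2,3) norm_triangle_ineq4[of u z] norm_ge_zero[of "F z - f"]
      norm_ge_zero[of "u - z"]
    by (intro mult_mono) linarith+
  finally have "- \<epsilon> * (norm u + R) \<le> (F z - f) \<bullet> (u - z)" by simp
  also have "\<dots> \<le> (F u - f) \<bullet> (u - z)"
    using assms(1) by (auto simp: monotone_operator_def inner_diff_left algebra_simps)
  finally show "- \<epsilon> * (norm u + R) \<le> (F u - f) \<bullet> (u - z)" .
qed

lemma solution_of_mem_all_minty_sets:
  fixes F :: "'a::real_inner \<Rightarrow> 'a"
  assumes cont: "continuous_on UNIV F"
    and p: "\<And>n. p \<in> minty_set F f R (1 / real (Suc n))"
  shows "F p = f"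
proof (rule minty[OF cont])
  fix u :: 'a
  have "(\<lambda>n. - (1 / real (Suc n)) * (norm u + R)) \<longlonglongrightarrow> - 0 * (norm u + R)"
    by (intro tendsto_intros LIMSEQ_Suc lim_1_over_n)
  then show "0 \<le> (F u - f) \<bullet> (u - p)"
    using p by (intro LIMSEQ_le_const2[of _ 0]) (auto simp: minty_set_def)
qed

section \<open>A priori norm bound from the discrepancy\<close>

text \<open>The discrepancy forces \<open>a * norm w\<close> to be at least
  \<open>c - \<theta> * \<delta>\<close>, so the total error is at most
  \<open>q * (a * norm w)\<close>. After testing monotonicity against \<open>y\<close>, both
  \<open>a\<close> and \<open>norm w\<close> cancel, which leaves a bound independent of
  \<open>a\<close>.\<close>

lemma regularized_norm_bound:
  fixes F :: "'a::real_inner \<Rightarrow> 'a"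
  assumes mono: "monotone_operator F" and y: "F y = f"
    and noise: "norm (g - f) \<le> \<delta>" and "0 < \<delta>" and "0 < a" and "0 \<le> \<theta>"
    and res: "norm (F w + a *\<^sub>R w - g) \<le> \<theta> * \<delta>"
    and disc: "c \<le> norm (F w - g)"
    and c: "(2 * \<theta> + 1) * \<delta> < c"
  defines "q \<equiv> (\<theta> + 1) * \<delta> / (c - \<theta> * \<delta>)"
  shows "norm w \<le> norm y * (1 + q) / (1 - q)"
proof -
  \<comment> \<open>This rearrangement of the hypothesis on \<open>c\<close> is what makes
    \<open>q < 1\<close>.\<close>
  have less: "(\<theta> + 1) * \<delta> < c - \<theta> * \<delta>" using c by (simp add: algebra_simps)
  have nonneg: "0 \<le> (\<theta> + 1) * \<delta>" using \<open>0 < \<delta>\<close> \<open>0 \<le> \<theta>\<close> by simp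
  have pos: "0 < c - \<theta> * \<delta>" using nonneg less by linarith
  have q1: "q < 1" and q0: "0 \<le> q"
    using less nonneg pos by (simp_all add: q_def)
  have "norm (F w - g) \<le> norm (F w + a *\<^sub>R w - g) + norm (a *\<^sub>R w)"
    using norm_triangle_ineq4[of "F w + a *\<^sub>R w - g" "a *\<^sub>R w"] by (simp add: algebra_simps)
  then have aw: "c - \<theta> * \<delta> \<le> a * norm w"
    using res disc \<open>0 < a\<close> by simp
  then have w0: "0 < norm w"
    using pos \<open>0 < a\<close> by (metis less_le_trans zero_less_mult_pos)
  \<comment> \<open>This equals \<open>F w + a *\<^sub>R w - f\<close>: residual and data noise
    combined.\<close>
  define e where "e = F w + a *\<^sub>R w - g + (g - f)"
  have e: "norm e \<le> (\<theta> + 1) * \<delta>"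
    unfolding e_def using norm_triangle_le[OF add_mono[OF res noise]] by (simp add: algebra_simps)
  have "0 \<le> (F w - f) \<bullet> (w - y)"
    using mono y by (auto simp: monotone_operator_def)
  then have "a * (w \<bullet> (w - y)) \<le> e \<bullet> (w - y)"
    by (simp add: e_def inner_add_left inner_diff_left)
  also have "\<dots> \<le> norm e * norm (w - y)"
    by (rule norm_cauchy_schwarz)
  also have "\<dots> \<le> ((\<theta> + 1) * \<delta>) * (norm w + norm y)"
    by (intro mult_mono e norm_triangle_ineq4) (use \<open>0 \<le> \<theta>\<close> \<open>0 < \<delta>\<close> in auto)
  also have "(\<theta> + 1) * \<delta> = q * (c - \<theta> * \<delta>)"
    using pos by (simp add: q_def)
  also have "q * (c - \<theta> * \<delta>) * (norm w + norm y) \<le> q * (a * norm w) * (norm w + norm y)"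
    using aw q0 by (intro mult_right_mono mult_left_mono) auto
  finally have "a * (w \<bullet> (w - y)) \<le> a * (q * norm w * (norm w + norm y))"
    by (simp add: mult_ac)
  then have "w \<bullet> (w - y) \<le> q * norm w * (norm w + norm y)"
    using \<open>0 < a\<close> by simp
  moreover have "norm w * (norm w - norm y) \<le> w \<bullet> (w - y)"
    using norm_cauchy_schwarz[of w y]
    by (simp add: inner_diff_right power2_norm_eq_inner[symmetric] power2_eq_square algebra_simps)
  ultimately have "norm w * (norm w - norm y) \<le> norm w * (q * (norm w + norm y))"
    by (simp add: mult_ac)
  then have "norm w - norm y \<le> q * (norm w + norm y)"
    using w0 by simp
  then show ?thesis using q1 by (simp add: pos_le_divide_eq algebra_simps)
qed

section \<open>Limits of powers of the noise level, and convergence\<close>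

lemma powr_tendsto_0_at_right:
  fixes a :: real
  assumes "0 < a"
  shows "((\<lambda>x. x powr a) \<longlongrightarrow> 0) (at_right 0)"
proof -
  have "\<forall>\<^sub>F x::real in at_right 0. 0 \<le> x"
    using eventually_at_right_less[of 0] by eventually_elim simp
  then have "((\<lambda>x::real. x powr a) \<longlongrightarrow> 0 powr a) (at_right 0)"
    using assms by (intro tendsto_powr2 tendsto_intros) auto
  then show ?thesis by simp
qed

lemma div_powr_tendsto_0:
  fixes \<gamma> :: real
  assumes "\<gamma> < 1"
  shows "((\<lambda>\<delta>. \<delta> / \<delta> powr \<gamma>) \<longlongrightarrow> 0) (at_right 0)"
proof -
  have "((\<lambda>\<delta>::real. \<delta> powr (1 - \<gamma>)) \<longlongrightarrow> 0) (at_right 0)"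
    using assms by (intro powr_tendsto_0_at_right) simp
  moreover have "\<forall>\<^sub>F \<delta>::real in at_right 0. \<delta> powr (1 - \<gamma>) = \<delta> / \<delta> powr \<gamma>"
    using eventually_at_right_less[of 0] by eventually_elim (simp add: powr_diff)
  ultimately show ?thesis by (simp add: tendsto_cong)
qed

theorem theorem7:
  fixes F :: "'a::{real_inner, complete_space} \<Rightarrow> 'a"
    and f y :: 'a
    and \<gamma> C \<theta> C1 C2 \<delta>0 :: real
    and f\<delta> v :: "real \<Rightarrow> 'a"
    and \<alpha> :: "real \<Rightarrow> real"
  assumes "monotone_operator F"
    and "continuous_on UNIV F"
    and "\<exists>u. F u = f"
    and "minimal_norm_solution F f y"
    and "0 < \<gamma>" and "\<gamma> < 1"
    and "C > 0" and "\<theta> > 0"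
    and "0 < C1" and "C1 < C2"
    and "0 < \<delta>0" and "\<delta>0 \<le> 1"
    and "\<And>\<delta>. \<delta> \<in> {0<..<\<delta>0} \<Longrightarrow> norm (f\<delta> \<delta> - f) \<le> \<delta>"
    and "\<And>\<delta>. \<delta> \<in> {0<..<\<delta>0} \<Longrightarrow> C * \<delta> powr \<gamma> > \<delta>"
    and "\<And>\<delta>. \<delta> \<in> {0<..<\<delta>0} \<Longrightarrow> norm (F 0 - f\<delta> \<delta>) > C * \<delta> powr \<gamma>"
    and "\<And>\<delta>. \<delta> \<in> {0<..<\<delta>0} \<Longrightarrow> \<alpha> \<delta> > 0"
    and "\<And>\<delta>. \<delta> \<in> {0<..<\<delta>0} \<Longrightarrow> norm (F (v \<delta>) + \<alpha> \<delta> *\<^sub>R v \<delta> - f\<delta> \<delta>) \<le> \<theta> * \<delta>"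
    and "\<And>\<delta>. \<delta> \<in> {0<..<\<delta>0} \<Longrightarrow> C1 * \<delta> powr \<gamma> \<le> norm (F (v \<delta>) - f\<delta> \<delta>)"
    and "\<And>\<delta>. \<delta> \<in> {0<..<\<delta>0} \<Longrightarrow> norm (F (v \<delta>) - f\<delta> \<delta>) \<le> C2 * \<delta> powr \<gamma>"
  shows "((\<lambda>\<delta>. norm (v \<delta> - y)) \<longlongrightarrow> 0) (at_right 0)"
proof -
  note mono = assms(1) and cont = assms(2)
  have Fy: "F y = f" and min: "\<And>p. F p = f \<Longrightarrow> norm y \<le> norm p"
    using assms(4) by (auto simp: minimal_norm_solution_def is_arg_min_linorder)
  \<comment> \<open>Any radius above \<open>norm y\<close> would do: the bound \<open>b\<close>,
    which tends to \<open>norm y\<close>, eventually falls below it.\<close>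
  define R where "R = norm y + 1"
  define K where "K n = minty_set F f R (1 / real (Suc n))" for n
  define r where "r \<delta> = \<delta> / \<delta> powr \<gamma>" for \<delta>
  define q where "q \<delta> = (\<theta> + 1) * \<delta> / (C1 * \<delta> powr \<gamma> - \<theta> * \<delta>)" for \<delta>
  define b where "b \<delta> = norm y * (1 + q \<delta>) / (1 - q \<delta>)" for \<delta>
  have small: "\<forall>\<^sub>F \<delta> in at_right 0. \<delta> \<in> {0<..<\<delta>0}"
    using eventually_at_right_real[OF \<open>0 < \<delta>0\<close>] .
  have r: "(r \<longlongrightarrow> 0) (at_right 0)"
    unfolding r_def by (rule div_powr_tendsto_0[OF \<open>\<gamma> < 1\<close>])
  \<comment> \<open>Dividing numerator and denominator of \<open>q\<close> by
    \<open>\<delta> powr \<gamma>\<close> expresses it through \<open>r\<close>, which vanishes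
    because \<open>\<gamma> < 1\<close>.\<close>
  have "((\<lambda>\<delta>. (\<theta> + 1) * r \<delta> / (C1 - \<theta> * r \<delta>)) \<longlongrightarrow> (\<theta> + 1) * 0 / (C1 - \<theta> * 0)) (at_right 0)"
    using \<open>0 < C1\<close> by (intro tendsto_intros r) simp
  moreover have "\<forall>\<^sub>F \<delta> in at_right 0. (\<theta> + 1) * r \<delta> / (C1 - \<theta> * r \<delta>) = q \<delta>"
    using small
  proof eventually_elim
    case (elim \<delta>)
    then have "\<delta> powr \<gamma> \<noteq> 0" by simp
    moreover have "C1 - \<theta> * r \<delta> = (C1 * \<delta> powr \<gamma> - \<theta> * \<delta>) / \<delta> powr \<gamma>"
      using elim by (simp add: r_def diff_divide_distrib)
    ultimately show ?case by (simp add: q_def r_def)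
  qed
  ultimately have q: "(q \<longlongrightarrow> 0) (at_right 0)"
    by (simp add: tendsto_cong)
  have "(b \<longlongrightarrow> norm y * (1 + 0) / (1 - 0)) (at_right 0)"
    unfolding b_def by (intro tendsto_intros q) simp
  then have b: "(b \<longlongrightarrow> norm y) (at_right 0)" by simp
  \<comment> \<open>The threshold is the last hypothesis of \<open>regularized_norm_bound\<close>
    with \<open>c = C1 * \<delta> powr \<gamma>\<close>, divided by
    \<open>\<delta> powr \<gamma>\<close>.\<close>
  have "\<forall>\<^sub>F \<delta> in at_right 0. r \<delta> < C1 / (2 * \<theta> + 1)"
    using \<open>0 < C1\<close> \<open>\<theta> > 0\<close> by (intro order_tendstoD(2)[OF r]) simp
  then have bound: "\<forall>\<^sub>F \<delta> in at_right 0. norm (v \<delta>) \<le> b \<delta>"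
    using small
  proof eventually_elim
    case (elim \<delta>)
    then have "(2 * \<theta> + 1) * \<delta> < C1 * \<delta> powr \<gamma>"
      using \<open>\<theta> > 0\<close> by (simp add: r_def field_simps)
    then show ?case
      unfolding b_def q_def
      using elim(2) \<open>\<theta> > 0\<close> assms(13,16,17,18)[OF elim(2)]
      by (intro regularized_norm_bound[OF mono Fy]) auto
  qed
  \<comment> \<open>The upper discrepancy bound plus the noise level dominates
    \<open>norm (F (v \<delta>) - f)\<close>.\<close>
  have "((\<lambda>\<delta>. C2 * \<delta> powr \<gamma> + \<delta>) \<longlongrightarrow> C2 * 0 + 0) (at_right 0)"
    by (intro tendsto_intros powr_tendsto_0_at_right \<open>0 < \<gamma>\<close>)
  then have res: "((\<lambda>\<delta>. C2 * \<delta> powr \<gamma> + \<delta>) \<longlongrightarrow> 0) (at_right 0)" by simp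
  have ev: "\<forall>\<^sub>F \<delta> in at_right 0. v \<delta> \<in> K n" for n
  proof -
    have "\<forall>\<^sub>F \<delta> in at_right 0. C2 * \<delta> powr \<gamma> + \<delta> < 1 / real (Suc n)"
      by (intro order_tendstoD(2)[OF res]) simp
    moreover have "\<forall>\<^sub>F \<delta> in at_right 0. b \<delta> < R"
      by (intro order_tendstoD(2)[OF b]) (simp add: R_def)
    ultimately show ?thesis
      using small bound
    proof eventually_elim
      case (elim \<delta>)
      have "norm (F (v \<delta>) - f) \<le> norm (F (v \<delta>) - f\<delta> \<delta>) + norm (f\<delta> \<delta> - f)"
        using norm_triangle_ineq[of "F (v \<delta>) - f\<delta> \<delta>" "f\<delta> \<delta> - f"] by simp
      then show ?case
        unfolding K_def using elim assms(13,19)[OF elim(3)] by (intro mem_minty_setI mono) linarith+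
    qed
  qed
  have "(v \<longlongrightarrow> y) (at_right 0)"
  proof (rule tendsto_of_nested_closed_convex[of K, OF _ _ _ _ _ ev bound b])
    show "decseq K"
      unfolding decseq_def K_def
      by (intro allI impI minty_set_mono) (auto simp: R_def intro: divide_left_mono)
    show "closed (K n)" "convex (K n)" for n
      by (simp_all add: K_def closed_minty_set convex_minty_set)
    show "y \<in> K n" for n
      unfolding K_def by (intro mem_minty_setI mono) (auto simp: R_def Fy)
    show "norm y \<le> norm p" if "\<And>n. p \<in> K n" for p
      by (rule min[OF solution_of_mem_all_minty_sets[OF cont that[unfolded K_def]]])
  qed
  then show ?thesis by (simp add: LIM_zero tendsto_norm_zero)
qed

end
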